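(* Let $G$ be a finite group with a unique conjugacy class of involutions and let $H\leqslant G$ be a subgroup of order $2$. Let $U$ be the principal $\mathbb{F}_2H$-module and let $T=U^G$ be the induced $\mathbb{F}_2G$-module. Then there is an extension $E$ of $T$ by $G$ such that all involutions of $E$ lie in $T$.
   Context: The principal $\mathbb{F}_2H$-module is the one-dimensional module $U=\mathbb{F}_2$ with trivial action of $H$. $U^G$ denotes the module induced from $H$ to $G$; since $G$ is finite it may be identified with the co-induced module, i.e. with the $\mathbb{F}_2$-space $\{f:G\to U\mid f(gh)=f(g)\ \forall g\in G,\ h\in H\}$ with right $G$-action $(fa)(g)=f(ag)$ for $a,g\in G$. An extension $E$ of a right $G$-module $T$ by $G$ is a group $E$ fitting in a short exact sequence $0\to T\to E\to G\to 1$ in which conjugation in $E$ induces on $T$ the given $G$-module structure (i.e. $e^{-1}te=tg$ for $t\in T$ and $e\in E$ mapping to $g\in G$); $T$ is identified with its image in $E$. An involution is an element of order $2$. *)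

theory Defs
  imports "HOL-Algebra.Algebra" "HOL-Library.Z2"
begin

definition involutions :: "('g, 'b) monoid_scheme \<Rightarrow> 'g set" where
  "involutions G = {x \<in> carrier G. group.ord G x = 2}"

definition conjugacy_class :: "('g, 'b) monoid_scheme \<Rightarrow> 'g \<Rightarrow> 'g set" where
  "conjugacy_class G x =
     orbit G (\<lambda>g. \<lambda>h \<in> carrier G. g \<otimes>\<^bsub>G\<^esub> h \<otimes>\<^bsub>G\<^esub> inv\<^bsub>G\<^esub> g) x"

text \<open>Right \<open>G\<close>-modules. The abelian group \<open>T\<close> is written multiplicatively (as a
  \<open>comm_group\<close>), and \<open>act t g\<close> stands for \<open>t g\<close>. An \<open>\<bbbF>\<^sub>2 G\<close>-module is such a module
  whose underlying group has exponent dividing 2: the scalar multiplication carries no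
  further information.\<close>

locale right_group_module = G?: group G + T?: comm_group T
  for G :: "('g, 'b) monoid_scheme" and T :: "('t, 'c) monoid_scheme"
    and act :: "'t \<Rightarrow> 'g \<Rightarrow> 't" +
  assumes act_closed: "t \<in> carrier T \<Longrightarrow> g \<in> carrier G \<Longrightarrow> act t g \<in> carrier T"
    and act_one: "t \<in> carrier T \<Longrightarrow> act t \<one>\<^bsub>G\<^esub> = t"
    and act_act: "t \<in> carrier T \<Longrightarrow> g \<in> carrier G \<Longrightarrow> h \<in> carrier G \<Longrightarrow>
                    act t (g \<otimes>\<^bsub>G\<^esub> h) = act (act t g) h"
    and act_add: "s \<in> carrier T \<Longrightarrow> t \<in> carrier T \<Longrightarrow> g \<in> carrier G \<Longrightarrow>
                    act (s \<otimes>\<^bsub>T\<^esub> t) g = act s g \<otimes>\<^bsub>T\<^esub> act t g"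

definition F2 :: "bit monoid" where
  "F2 = \<lparr>carrier = UNIV, monoid.mult = (+), one = 0\<rparr>"

definition trivial_act :: "'u \<Rightarrow> 'g \<Rightarrow> 'u" where
  "trivial_act u h = u"

text \<open>The module induced from a subgroup \<open>H\<close> of a finite group \<open>G\<close>, in its co-induced form:
  the \<open>H\<close>-equivariant functions \<open>f : G \<rightarrow> U\<close>, with \<open>(f a) g = f (a g)\<close>. Functions are
  extensional on \<open>carrier G\<close>, so that each is represented exactly once. For trivial \<open>U\<close>,
  equivariance says \<open>f (g h) = f g\<close>.\<close>

definition induced_module ::
  "('g, 'b) monoid_scheme \<Rightarrow> 'g set \<Rightarrow> ('u, 'c) monoid_scheme \<Rightarrow> ('u \<Rightarrow> 'g \<Rightarrow> 'u) \<Rightarrow> ('g \<Rightarrow> 'u) monoid"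
where
  "induced_module G H U actU =
     \<lparr>carrier = {f \<in> carrier G \<rightarrow>\<^sub>E carrier U.
                   \<forall>g \<in> carrier G. \<forall>h \<in> H. f (g \<otimes>\<^bsub>G\<^esub> h) = actU (f g) h},
      monoid.mult = (\<lambda>f f'. \<lambda>g \<in> carrier G. f g \<otimes>\<^bsub>U\<^esub> f' g),
      one = (\<lambda>g \<in> carrier G. \<one>\<^bsub>U\<^esub>)\<rparr>"

definition induced_act ::
  "('g, 'b) monoid_scheme \<Rightarrow> ('g \<Rightarrow> 'u) \<Rightarrow> 'g \<Rightarrow> ('g \<Rightarrow> 'u)" where
  "induced_act G f a = (\<lambda>g \<in> carrier G. f (a \<otimes>\<^bsub>G\<^esub> g))"

locale module_extension = right_group_module G T act + E?: group E
  for G :: "('g, 'b) monoid_scheme" and T :: "('t, 'c) monoid_scheme"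
    and act :: "'t \<Rightarrow> 'g \<Rightarrow> 't"
    and E :: "('e, 'd) monoid_scheme" and \<iota> :: "'t \<Rightarrow> 'e" and \<pi> :: "'e \<Rightarrow> 'g" +
  assumes incl_mon: "\<iota> \<in> mon T E"
    and proj_epi: "\<pi> \<in> epi E G"
    and exact: "\<iota> ` carrier T = kernel E G \<pi>"
    and conj_action: "t \<in> carrier T \<Longrightarrow> e \<in> carrier E \<Longrightarrow>
                        inv\<^bsub>E\<^esub> e \<otimes>\<^bsub>E\<^esub> \<iota> t \<otimes>\<^bsub>E\<^esub> e = \<iota> (act t (\<pi> e))"

lemma F2_trivial_module:
  assumes "group H"
  shows "right_group_module H F2 trivial_act"
proof -
  have "comm_group F2"
    by (rule comm_groupI) (auto simp: F2_def ac_simps)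
  then show ?thesis
    using assms by (simp add: right_group_module_def right_group_module_axioms_def trivial_act_def)
qed

lemma induced_module_is_module:
  assumes G: "group G" and H: "subgroup H G"
    and U: "right_group_module (G\<lparr>carrier := H\<rparr>) U actU"
  shows "right_group_module G (induced_module G H U actU) (induced_act G)"
proof -
  interpret G: group G by fact
  interpret U: right_group_module "G\<lparr>carrier := H\<rparr>" U actU by fact
  have HG: "h \<in> carrier G" if "h \<in> H" for h
    using subgroup.mem_carrier[OF H that] .
  have one: "actU \<one>\<^bsub>U\<^esub> h = \<one>\<^bsub>U\<^esub>" if "h \<in> H" for h
  proof -
    have "actU \<one>\<^bsub>U\<^esub> h \<otimes>\<^bsub>U\<^esub> actU \<one>\<^bsub>U\<^esub> h = actU \<one>\<^bsub>U\<^esub> h"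
      using U.act_add[of "\<one>\<^bsub>U\<^esub>" "\<one>\<^bsub>U\<^esub>" h] that by simp
    then show ?thesis using U.act_closed[of "\<one>\<^bsub>U\<^esub>" h] that by simp
  qed
  have inv: "actU (inv\<^bsub>U\<^esub> u) h = inv\<^bsub>U\<^esub> (actU u h)" if "u \<in> carrier U" "h \<in> H" for u h
  proof -
    have "actU (inv\<^bsub>U\<^esub> u) h \<otimes>\<^bsub>U\<^esub> actU u h = \<one>\<^bsub>U\<^esub>"
      using U.act_add[of "inv\<^bsub>U\<^esub> u" u h] that one by simp
    then show ?thesis using U.act_closed that by (simp add: U.T.inv_equality)
  qed
  let ?T = "induced_module G H U actU"
  have "comm_group ?T"
  proof (rule comm_groupI)
    fix x assume x: "x \<in> carrier ?T"
    show "\<exists>y \<in> carrier ?T. y \<otimes>\<^bsub>?T\<^esub> x = \<one>\<^bsub>?T\<^esub>"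
      using x HG inv
      by (intro bexI[of _ "\<lambda>g \<in> carrier G. inv\<^bsub>U\<^esub> (x g)"])
         (auto simp: induced_module_def PiE_iff fun_eq_iff)
  qed (use HG one U.act_add in \<open>auto simp: induced_module_def PiE_iff fun_eq_iff
         extensional_def U.T.m_ac\<close>)
  then show ?thesis
    unfolding right_group_module_def right_group_module_axioms_def
    using G HG
    by (auto simp: induced_module_def induced_act_def PiE_iff fun_eq_iff extensional_def simp flip: G.m_assoc)
qed

lemma induced_F2_exponent_two:
  "f \<otimes>\<^bsub>induced_module G H F2 trivial_act\<^esub> f = \<one>\<^bsub>induced_module G H F2 trivial_act\<^esub>"
  by (auto simp: induced_module_def F2_def restrict_def)

end

theory Submission
  imports Defs
begin

text \<open>Let \<open>H = {1, z}\<close>. By Shapiro's lemma \<open>H\<^sup>2(G, T) = H\<^sup>2(H, \<bbbF>\<^sub>2)\<close> has order 2, and \<open>E\<close> is the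
  extension belonging to the nonzero class, the one of the cyclic group of order 4. Concretely,
  let \<open>\<epsilon> : G \<rightarrow> \<bbbF>\<^sub>2\<close> satisfy \<open>\<epsilon> (g z) = \<epsilon> g + 1\<close>. Then \<open>\<epsilon>\<^sub>a g = \<epsilon> (a g) + \<epsilon> g\<close> is a crossed
  homomorphism \<open>G \<rightarrow> T\<close>, and its Bockstein, the carry \<open>c(a, b) g = \<epsilon>\<^sub>a (b g) \<cdot> \<epsilon>\<^sub>b g\<close> of the sum
  \<open>\<epsilon>\<^sub>a\<^sub>b g = \<epsilon>\<^sub>a (b g) + \<epsilon>\<^sub>b g\<close> lifted to \<open>\<int>/4\<close>, is the cocycle. If an involution of \<open>E\<close> maps to
  \<open>a = x z x\<^sup>-\<^sup>1\<close>, then \<open>a x = x z\<close>, and the \<open>T\<close>-component of its square takes at \<open>x\<close> the value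
  \<open>(\<epsilon> (x z) + \<epsilon> x)\<^sup>2 = 1\<close>, a contradiction.\<close>

declare add_bit_eq_xor [simp del] mult_bit_eq_and [simp del]

lemma bit_add_self [simp]: "b + b = 0" "b + (b + c) = c" for b c :: bit
  by (cases b; cases c; simp)+

text \<open>The case \<open>g = \<one>\<close> of \<open>sign_mult\<close> forces \<open>z\<close>
  to differ from \<open>\<one>\<close>, so \<open>{\<one>, z}\<close> has order 2.\<close>

locale sign_function = group G for G (structure) +
  fixes z and \<epsilon> :: "'a \<Rightarrow> bit"
  assumes z_closed [simp]: "z \<in> carrier G"
    and sign_mult: "g \<in> carrier G \<Longrightarrow> \<epsilon> (g \<otimes> z) = \<epsilon> g + 1"
    and subgroup_z: "subgroup {\<one>, z} G"
begin

abbreviation T :: "('a \<Rightarrow> bit) monoid" where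
  "T \<equiv> induced_module G {\<one>, z} F2 trivial_act"

definition sign_diff :: "'a \<Rightarrow> 'a \<Rightarrow> bit" where
  "sign_diff a g = \<epsilon> (a \<otimes> g) + \<epsilon> g"

text \<open>The term \<open>t (b \<otimes> g)\<close> is the right action of \<open>b\<close> on
  \<open>t\<close>; the product of sign differences is the cup square of the crossed homomorphism
  \<open>sign_diff\<close>.\<close>

definition E :: "(('a \<Rightarrow> bit) \<times> 'a) monoid" where
  "E = \<lparr>carrier = carrier T \<times> carrier G,
        monoid.mult = (\<lambda>(t, a) (s, b).
          (\<lambda>g \<in> carrier G. t (b \<otimes> g) + s g + sign_diff a (b \<otimes> g) * sign_diff b g, a \<otimes> b)),
        one = (\<lambda>g \<in> carrier G. 0, \<one>)\<rparr>"

lemma carrier_T: "t \<in> carrier T \<longleftrightarrow>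
    t \<in> extensional (carrier G) \<and> (\<forall>g \<in> carrier G. t (g \<otimes> z) = t g)"
  by (auto simp: induced_module_def F2_def trivial_act_def PiE_def)

lemma mult_T: "t \<otimes>\<^bsub>T\<^esub> s = (\<lambda>g \<in> carrier G. t g + s g)"
  by (simp add: induced_module_def F2_def)

lemma sign_diff_one: "g \<in> carrier G \<Longrightarrow> sign_diff \<one> g = 0"
  by (simp add: sign_diff_def)

lemma sign_diff_mult:
  "a \<in> carrier G \<Longrightarrow> b \<in> carrier G \<Longrightarrow> g \<in> carrier G \<Longrightarrow>
     sign_diff (a \<otimes> b) g = sign_diff a (b \<otimes> g) + sign_diff b g"
  by (simp add: sign_diff_def m_assoc add.assoc)

text \<open>The two increments of \<open>\<epsilon>\<close> cancel, so \<open>sign_diff a\<close> is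
  constant on cosets of \<open>{\<one>, z}\<close>, as \<open>T\<close> demands, although
  \<open>\<epsilon>\<close> is not.\<close>

lemma sign_diff_z:
  "a \<in> carrier G \<Longrightarrow> g \<in> carrier G \<Longrightarrow> sign_diff a (g \<otimes> z) = sign_diff a g"
  by (simp add: sign_diff_def sign_mult ac_simps flip: m_assoc)

lemma mult_E: "(t, a) \<otimes>\<^bsub>E\<^esub> (s, b) =
    (\<lambda>g \<in> carrier G. t (b \<otimes> g) + s g + sign_diff a (b \<otimes> g) * sign_diff b g, a \<otimes> b)"
  by (simp add: E_def)

lemma carrier_E: "carrier E = carrier T \<times> carrier G"
  by (simp add: E_def)

lemma one_E: "\<one>\<^bsub>E\<^esub> = (\<lambda>g \<in> carrier G. 0, \<one>)"
  by (simp add: E_def)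

lemma group_E: "group E"
proof (rule groupI)
  fix x y assume "x \<in> carrier E" "y \<in> carrier E"
  then show "x \<otimes>\<^bsub>E\<^esub> y \<in> carrier E"
    by (auto simp: carrier_E mult_E carrier_T sign_diff_z simp flip: m_assoc)
next
  show "\<one>\<^bsub>E\<^esub> \<in> carrier E"
    by (auto simp: carrier_E one_E carrier_T)
next
  fix x y w assume "x \<in> carrier E" "y \<in> carrier E" "w \<in> carrier E"
  \<comment> \<open>With A, B, C the sign differences of the three factors at the shifted arguments,
    the crossed homomorphism rule turns both cocycle terms into AB + AC + BC.\<close>
  then show "x \<otimes>\<^bsub>E\<^esub> y \<otimes>\<^bsub>E\<^esub> w = x \<otimes>\<^bsub>E\<^esub> (y \<otimes>\<^bsub>E\<^esub> w)"
    by (auto simp: carrier_E mult_E sign_diff_mult m_assoc algebra_simps cong: restrict_cong)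
next
  fix x assume "x \<in> carrier E"
  then show "\<one>\<^bsub>E\<^esub> \<otimes>\<^bsub>E\<^esub> x = x"
    by (auto simp: carrier_E one_E mult_E carrier_T sign_diff_one fun_eq_iff extensional_def)
next
  fix x assume "x \<in> carrier E"
  then obtain t a where x: "x = (t, a)" and t: "t \<in> carrier T" and a: "a \<in> carrier G"
    by (auto simp: carrier_E)
  \<comment> \<open>Obtained by setting the first component of the product to 0 at
    \<open>inv a \<otimes> g\<close>; signs do not matter in characteristic 2.\<close>
  let ?s = "\<lambda>g \<in> carrier G. t (inv a \<otimes> g) + sign_diff (inv a) g * sign_diff a (inv a \<otimes> g)"
  have "?s \<in> carrier T"
    using t a by (auto simp: carrier_T sign_diff_z simp flip: m_assoc)
  moreover have "(?s, inv a) \<otimes>\<^bsub>E\<^esub> x = \<one>\<^bsub>E\<^esub>"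
    using t a by (auto simp: x mult_E one_E carrier_T fun_eq_iff simp flip: m_assoc)
  ultimately show "\<exists>y \<in> carrier E. y \<otimes>\<^bsub>E\<^esub> x = \<one>\<^bsub>E\<^esub>"
    using a by (auto simp: carrier_E)
qed

lemma extension_E: "module_extension G T (induced_act G) E (\<lambda>t. (t, \<one>)) snd"
proof -
  have "right_group_module G T (induced_act G)"
    by (intro induced_module_is_module F2_trivial_module subgroup_z
        subgroup.subgroup_is_group is_group)
  then interpret M: right_group_module G T "induced_act G" .
  interpret E: group E by (rule group_E)
  show ?thesis
  proof unfold_locales
    show "(\<lambda>t. (t, \<one>)) \<in> mon T E"
      by (auto simp: mon_def hom_def inj_on_def carrier_E mult_E mult_T sign_diff_one
          cong: restrict_cong)
  next
    show "snd \<in> epi E G"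
      using M.T.one_closed
      by (force simp: epi_def hom_def carrier_E mult_E)
  next
    show "(\<lambda>t. (t, \<one>)) ` carrier T = kernel E G snd"
      by (auto simp: kernel_def carrier_E)
  next
    fix t e assume t: "t \<in> carrier T" and e: "e \<in> carrier E"
    then obtain s a where e_eq: "e = (s, a)" and s: "s \<in> carrier T" and a: "a \<in> carrier G"
      by (auto simp: carrier_E)
    \<comment> \<open>The action law without inverses: both cocycle terms contain a factor
      \<open>sign_diff \<one>\<close>, which is 0.\<close>
    have "(t, \<one>) \<otimes>\<^bsub>E\<^esub> e = e \<otimes>\<^bsub>E\<^esub> (induced_act G t a, \<one>)"
      using s t a
      by (auto simp: e_eq mult_E sign_diff_one induced_act_def fun_eq_iff)
    moreover have "(t, \<one>) \<in> carrier E" "(induced_act G t a, \<one>) \<in> carrier E"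
      using t a M.act_closed by (auto simp: carrier_E)
    ultimately show "inv\<^bsub>E\<^esub> e \<otimes>\<^bsub>E\<^esub> (t, \<one>) \<otimes>\<^bsub>E\<^esub> e = (induced_act G t (snd e), \<one>)"
      using e by (simp add: E.m_assoc e_eq) (simp flip: E.m_assoc)
  qed
qed

lemma square_E_neq_one:
  assumes t: "t \<in> carrier T" and x: "x \<in> carrier G"
  shows "(t, x \<otimes> z \<otimes> inv x) \<otimes>\<^bsub>E\<^esub> (t, x \<otimes> z \<otimes> inv x) \<noteq> \<one>\<^bsub>E\<^esub>"
proof
  let ?a = "x \<otimes> z \<otimes> inv x"
  assume "(t, ?a) \<otimes>\<^bsub>E\<^esub> (t, ?a) = \<one>\<^bsub>E\<^esub>"
  then have "t (?a \<otimes> x) + t x + sign_diff ?a (?a \<otimes> x) * sign_diff ?a x = 0"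
    using x by (auto simp: mult_E one_E dest: fun_cong[of _ _ x])
  moreover have ax: "?a \<otimes> x = x \<otimes> z"
    using x by (simp add: m_assoc)
  moreover have "sign_diff ?a x = 1"
    using x by (simp add: sign_diff_def ax sign_mult)
  \<comment> \<open>As \<open>?a \<otimes> x = x \<otimes> z\<close>, invariance under
    \<open>z\<close> cancels the two values of \<open>t\<close> and makes both factors 1.\<close>
  ultimately show False
    using t x by (simp add: sign_diff_z carrier_T)
qed

end

lemma (in group) involution_iff:
  "x \<in> involutions G \<longleftrightarrow> x \<in> carrier G \<and> x \<noteq> \<one> \<and> x \<otimes> x = \<one>"
proof -
  have "ord x = 2 \<longleftrightarrow> x \<noteq> \<one> \<and> x \<otimes> x = \<one>" if x: "x \<in> carrier G"
  proof
    assume "ord x = 2"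
    then show "x \<noteq> \<one> \<and> x \<otimes> x = \<one>"
      using x pow_ord_eq_1[OF x] ord_eq_1[OF x] by (simp add: numeral_2_eq_2)
  next
    assume *: "x \<noteq> \<one> \<and> x \<otimes> x = \<one>"
    then have "ord x dvd 2"
      using x pow_eq_id[OF x, of 2] by (simp add: numeral_2_eq_2)
    then have "ord x = 1 \<or> ord x = 2"
      using prime_nat_iff two_is_prime_nat by blast
    then show "ord x = 2"
      using * x ord_eq_1[OF x] by simp
  qed
  then show ?thesis by (auto simp: involutions_def)
qed

lemma (in group) self_in_conjugacy_class:
  "x \<in> carrier G \<Longrightarrow> x \<in> conjugacy_class G x"
  unfolding conjugacy_class_def orbit_def by (intro CollectI exI[of _ \<one>]) simp

text \<open>\<open>\<epsilon>\<close> is the indicator of the complement of a transversal of the cosets \<open>{g, g z}\<close>.\<close>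

lemma (in group) ex_sign_function:
  assumes "z \<in> involutions G"
  obtains \<epsilon> :: "'a \<Rightarrow> bit" where "\<And>g. g \<in> carrier G \<Longrightarrow> \<epsilon> (g \<otimes> z) = \<epsilon> g + 1"
proof
  have z: "z \<in> carrier G" "z \<noteq> \<one>" "z \<otimes> z = \<one>"
    using assms by (auto simp: involution_iff)
  fix g assume g: "g \<in> carrier G"
  \<comment> \<open>The choice depends only on the set, so \<open>g\<close> and
    \<open>g \<otimes> z\<close> share one representative.\<close>
  let ?r = "\<lambda>g. SOME y. y \<in> {g, g \<otimes> z}"
  have "g \<otimes> z \<otimes> z = g" using g z by (simp add: m_assoc)
  then have "?r (g \<otimes> z) = ?r g" by (simp add: insert_commute disj_commute)
  moreover have "?r g \<in> {g, g \<otimes> z}" by (rule someI[of _ g]) simp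
  moreover have "g \<otimes> z \<noteq> g" using g z by simp
  \<comment> \<open>This instantiates the \<open>\<epsilon>\<close> left schematic by
    \<open>proof\<close>.\<close>
  ultimately show "of_bool (?r (g \<otimes> z) \<noteq> g \<otimes> z) = (of_bool (?r g \<noteq> g) + 1 :: bit)"
    by auto
qed

theorem proposition8:
  fixes G :: "('g, 'b) monoid_scheme" and H :: "'g set"
  assumes "group G" and "finite (carrier G)"
    and "\<exists>!C. C \<in> conjugacy_class G ` involutions G"
    and "subgroup H G" and "card H = 2"
  shows "\<exists>(E :: (('g \<Rightarrow> bit) \<times> 'g) monoid) \<iota> \<pi>.
           module_extension G (induced_module G H F2 trivial_act) (induced_act G) E \<iota> \<pi> \<and>
           involutions E \<subseteq> \<iota> ` carrier (induced_module G H F2 trivial_act)"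
proof -
  interpret group G by fact
  obtain z where H: "H = {\<one>\<^bsub>G\<^esub>, z}" and "z \<noteq> \<one>\<^bsub>G\<^esub>"
    using \<open>card H = 2\<close> subgroup.one_closed[OF \<open>subgroup H G\<close>]
    by (auto simp: card_2_iff)
  moreover from H have "z \<in> H" by simp
  then have "z \<otimes>\<^bsub>G\<^esub> z \<in> H" "z \<in> carrier G"
    using \<open>subgroup H G\<close> by (simp_all only: subgroup.m_closed subgroup.mem_carrier)
  ultimately have z: "z \<in> involutions G"
    by (auto simp: involution_iff H)
  obtain \<epsilon> :: "'g \<Rightarrow> bit"
    where "\<And>g. g \<in> carrier G \<Longrightarrow> \<epsilon> (g \<otimes>\<^bsub>G\<^esub> z) = \<epsilon> g + 1"
    using ex_sign_function[OF z] by blast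
  then interpret sign_function G z \<epsilon>
    using \<open>subgroup H G\<close> \<open>z \<in> carrier G\<close>
    by (intro sign_function.intro sign_function_axioms.intro is_group) (simp_all add: H)
  interpret E: group E by (rule group_E)
  have "involutions E \<subseteq> (\<lambda>t. (t, \<one>\<^bsub>G\<^esub>)) ` carrier T"
  proof
    fix y assume "y \<in> involutions E"
    then obtain t a where y: "y = (t, a)" and t: "t \<in> carrier T" and a: "a \<in> carrier G"
      and sq: "(t, a) \<otimes>\<^bsub>E\<^esub> (t, a) = \<one>\<^bsub>E\<^esub>"
      by (auto simp: E.involution_iff carrier_E)
    have "a = \<one>\<^bsub>G\<^esub>"
    proof (rule ccontr)
      assume "a \<noteq> \<one>\<^bsub>G\<^esub>"
      then have "a \<in> involutions G"
        using a sq by (simp add: involution_iff mult_E one_E)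
      \<comment> \<open>Uniqueness of the class makes \<open>a\<close> a conjugate of
        \<open>z\<close>, the case excluded by \<open>square_E_neq_one\<close>.\<close>
      then have "conjugacy_class G a = conjugacy_class G z"
        using z assms(3) by blast
      then obtain x where "x \<in> carrier G" "a = x \<otimes>\<^bsub>G\<^esub> z \<otimes>\<^bsub>G\<^esub> inv\<^bsub>G\<^esub> x"
        using self_in_conjugacy_class[OF a] \<open>z \<in> carrier G\<close>
        by (auto simp: conjugacy_class_def orbit_def)
      then show False
        using square_E_neq_one[OF t] sq by blast
    qed
    then show "y \<in> (\<lambda>t. (t, \<one>\<^bsub>G\<^esub>)) ` carrier T"
      using y t by blast
  qed
  then show ?thesis
    using extension_E by (auto simp: H)
qed

end
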